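(* Assume $\big(A(t),B(t)\big)$ is totally controllable on $[0,1]$. Let a symmetric matrix $\Pi(s)\in\mathbb{R}^{n\times n}$ for some $s\in[0,1]$ be given. Then the Riccati differential equation $$\dot{\Pi} = - A(t)^{T} \Pi - \Pi A(t) + \Pi B(t) B(t)^{T} \Pi - Q(t)$$ with this prescribed value at time $s$ admits a unique solution $\Pi(t)$ on $[0,1]$ if and only if $$- \Phi_{12}(0, s)^{-1} \Phi_{11}(0, s) \prec \Pi(s) \prec - \Phi_{12}(1, s)^{-1} \Phi_{11}(1, s), \qquad ( * )$$ where by convention $\Phi_{12}(0,0^{+})^{-1}=+\infty$ and $\Phi_{12}(1,1^{-})^{-1}=-\infty$ (so that the left inequality is void when $s=0$ and the right inequality is void when $s=1$). Moreover, in this case, $$\Pi(t) = \big(\Phi_{21}(t, s) + \Phi_{22}(t, s) \Pi(s)\big)\big(\Phi_{11}(t, s) + \Phi_{12}(t, s) \Pi(s)\big)^{-1},\qquad t\in[0,1],$$ and $$- \Phi_{12}(0, t)^{-1} \Phi_{11}(0, t) \prec \Pi(t) \prec - \Phi_{12}(1, t)^{-1} \Phi_{11}(1, t), \qquad t \in [0, 1],$$ with the same conventions at $t=0$ and $t=1$.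
   Context: $A\in\mathcal{C}^{n-1}$, $B\in\mathcal{C}^{n}$ on $[0,1]$ ($\mathcal{C}^k$: $k$-times continuously differentiable), $A(t)\in\mathbb{R}^{n\times n}$, $B(t)\in\mathbb{R}^{n\times p}$; $Q(t)\in\mathbb{R}^{n\times n}$ is symmetric, continuous, $Q(t)\succeq 0$. $\prec$, $\succeq$ denote the Loewner order on symmetric matrices. $\Phi_M(t,s)=\begin{bmatrix}\Phi_{11}(t,s)&\Phi_{12}(t,s)\\ \Phi_{21}(t,s)&\Phi_{22}(t,s)\end{bmatrix}$ ($n\times n$ blocks) is the state transition matrix of $M(t)=\begin{bmatrix}A(t)&-B(t)B(t)^{T}\\-Q(t)&-A(t)^{T}\end{bmatrix}$, i.e. $\frac{\partial}{\partial t}\Phi_M(t,s)=M(t)\Phi_M(t,s)$, $\Phi_M(s,s)=I_{2n}$. Under total controllability, $\Phi_{12}(t,s)$ is invertible for $t\ne s$. Total controllability: let $\Gamma_0(t)=B(t)$, $\Gamma_k(t)=-A(t)\Gamma_{k-1}(t)+\dot\Gamma_{k-1}(t)$ for $k\ge1$, and $\Theta_n(t)=[\Gamma_0(t)\ \cdots\ \Gamma_{n-1}(t)]$. $(A(t),B(t))$ is totally controllable on $[0,1]$ if for all $0\le t_0<t_1\le1$ there is $t\in(t_0,t_1)$ with $\operatorname{rank}\Theta_n(t)=n$. *)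

theory Defs
  imports "HOL-Analysis.Analysis"
begin

text \<open>Derivatives are taken within the set, hence one-sided at the endpoints of an interval.\<close>

primrec Ck_on :: "nat \<Rightarrow> (real \<Rightarrow> 'a::real_normed_vector) \<Rightarrow> real set \<Rightarrow> bool" where
  "Ck_on 0 f S \<longleftrightarrow> continuous_on S f"
| "Ck_on (Suc k) f S \<longleftrightarrow>
     (\<forall>t\<in>S. f differentiable (at t within S)) \<and>
     Ck_on k (\<lambda>t. vector_derivative f (at t within S)) S"

definition sym_matrix :: "real^'n^'n \<Rightarrow> bool" where
  "sym_matrix X \<longleftrightarrow> transpose X = X"

definition loewner_le :: "real^'n^'n \<Rightarrow> real^'n^'n \<Rightarrow> bool"  (infix "\<preceq>\<^sub>L" 50) where
  "X \<preceq>\<^sub>L Y \<longleftrightarrow> sym_matrix X \<and> sym_matrix Y \<and> (\<forall>v. 0 \<le> v \<bullet> ((Y - X) *v v))"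

definition loewner_less :: "real^'n^'n \<Rightarrow> real^'n^'n \<Rightarrow> bool"  (infix "\<prec>\<^sub>L" 50) where
  "X \<prec>\<^sub>L Y \<longleftrightarrow> sym_matrix X \<and> sym_matrix Y \<and> (\<forall>v. v \<noteq> 0 \<longrightarrow> 0 < v \<bullet> ((Y - X) *v v))"

primrec Gam :: "(real \<Rightarrow> real^'n^'n) \<Rightarrow> (real \<Rightarrow> real^'p^'n) \<Rightarrow> nat \<Rightarrow> real \<Rightarrow> real^'p^'n" where
  "Gam A B 0 = B"
| "Gam A B (Suc k) =
     (\<lambda>t. - (A t ** Gam A B k t) + vector_derivative (Gam A B k) (at t within {0..1}))"

text \<open>The \<open>n \<times> np\<close> matrix \<open>[\<Gamma>\<^sub>0(t) \<dots> \<Gamma>\<^sub>n\<^sub>-\<^sub>1(t)]\<close>, with \<open>n = CARD('n)\<close>. Its columns are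
  indexed by \<open>'n \<times> 'p\<close>, where \<^term>\<open>to_nat_on (UNIV :: 'n set)\<close> is a bijection from \<open>'n\<close> onto
  \<open>{..<n}\<close> and supplies the block number. Which bijection is used only affects the order
  of the blocks.\<close>

definition Theta ::
  "(real \<Rightarrow> real^'n^'n) \<Rightarrow> (real \<Rightarrow> real^'p^'n) \<Rightarrow> real \<Rightarrow> real^('n::finite \<times> 'p::finite)^'n" where
  "Theta A B t = (\<chi> i c. Gam A B (to_nat_on (UNIV :: 'n set) (fst c)) t $ i $ snd c)"

lemma columns_Theta:
  fixes A :: "real \<Rightarrow> real^'n^'n" and B :: "real \<Rightarrow> real^'p^'n"
  shows "columns (Theta A B t) = (\<Union>k<CARD('n). columns (Gam A B k t))"
proof -
  have b: "to_nat_on (UNIV :: 'n set) ` UNIV = {..<CARD('n)}"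
    using to_nat_on_finite[of "UNIV :: 'n set"] by (simp add: bij_betw_def)
  have c: "column (m, j) (Theta A B t) = column j (Gam A B (to_nat_on (UNIV :: 'n set) m) t)"
    for m :: 'n and j :: 'p
    by (simp add: column_def Theta_def)
  have "columns (Theta A B t) = (\<Union>m::'n. columns (Gam A B (to_nat_on (UNIV :: 'n set) m) t))"
    by (auto simp: columns_def c[symmetric])
  also have "\<dots> = (\<Union>k\<in>to_nat_on (UNIV :: 'n set) ` UNIV. columns (Gam A B k t))"
    by simp
  finally show ?thesis by (simp only: b)
qed

definition totally_controllable ::
  "(real \<Rightarrow> real^'n^'n) \<Rightarrow> (real \<Rightarrow> real^'p^'n) \<Rightarrow> bool" where
  "totally_controllable A B \<longleftrightarrow>
     (\<forall>t0 t1. 0 \<le> t0 \<and> t0 < t1 \<and> t1 \<le> 1 \<longrightarrow>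
        (\<exists>t\<in>{t0<..<t1}. rank (Theta A B t) = CARD('n)))"

text \<open>Matrices of size \<open>2n \<times> 2n\<close> are indexed by \<open>'n + 'n\<close>.\<close>

definition block_mat ::
  "real^'n^'n \<Rightarrow> real^'n^'n \<Rightarrow> real^'n^'n \<Rightarrow> real^'n^'n \<Rightarrow> real^('n::finite + 'n)^('n + 'n)" where
  "block_mat X11 X12 X21 X22 = (\<chi> i j.
     case i of
       Inl a \<Rightarrow> (case j of Inl b \<Rightarrow> X11 $ a $ b | Inr b \<Rightarrow> X12 $ a $ b)
     | Inr a \<Rightarrow> (case j of Inl b \<Rightarrow> X21 $ a $ b | Inr b \<Rightarrow> X22 $ a $ b))"

definition blk11 :: "real^('n::finite + 'n)^('n + 'n) \<Rightarrow> real^'n^'n" where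
  "blk11 X = (\<chi> a b. X $ Inl a $ Inl b)"

definition blk12 :: "real^('n::finite + 'n)^('n + 'n) \<Rightarrow> real^'n^'n" where
  "blk12 X = (\<chi> a b. X $ Inl a $ Inr b)"

definition blk21 :: "real^('n::finite + 'n)^('n + 'n) \<Rightarrow> real^'n^'n" where
  "blk21 X = (\<chi> a b. X $ Inr a $ Inl b)"

definition blk22 :: "real^('n::finite + 'n)^('n + 'n) \<Rightarrow> real^'n^'n" where
  "blk22 X = (\<chi> a b. X $ Inr a $ Inr b)"

definition ham_matrix ::
  "(real \<Rightarrow> real^'n^'n) \<Rightarrow> (real \<Rightarrow> real^'p^'n) \<Rightarrow> (real \<Rightarrow> real^'n^'n) \<Rightarrow> real
     \<Rightarrow> real^('n::finite + 'n)^('n + 'n)" where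
  "ham_matrix A B Q t =
     block_mat (A t) (- (B t ** transpose (B t))) (- Q t) (- transpose (A t))"

text \<open>For continuous \<open>M\<close> this determines \<open>\<Phi>\<close> uniquely on \<open>[0,1] \<times> [0,1]\<close>.\<close>

definition state_transition ::
  "(real \<Rightarrow> real^'m^'m) \<Rightarrow> (real \<Rightarrow> real \<Rightarrow> real^'m^'m) \<Rightarrow> bool" where
  "state_transition M \<Phi> \<longleftrightarrow>
     (\<forall>s\<in>{0..1}. \<Phi> s s = mat 1 \<and>
        (\<forall>t\<in>{0..1}. ((\<lambda>t. \<Phi> t s) has_vector_derivative M t ** \<Phi> t s) (at t within {0..1})))"

definition riccati_solution ::
  "(real \<Rightarrow> real^'n^'n) \<Rightarrow> (real \<Rightarrow> real^'p^'n) \<Rightarrow> (real \<Rightarrow> real^'n^'n)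
     \<Rightarrow> real \<Rightarrow> real^'n^'n \<Rightarrow> (real \<Rightarrow> real^'n^'n) \<Rightarrow> bool" where
  "riccati_solution A B Q s P0 P \<longleftrightarrow>
     P s = P0 \<and>
     (\<forall>t\<in>{0..1}. (P has_vector_derivative
        (- (transpose (A t) ** P t) - P t ** A t
           + P t ** B t ** transpose (B t) ** P t - Q t)) (at t within {0..1}))"

text \<open>The guards encode the conventions that the lower bound is void at \<open>t = 0\<close> and the upper
  bound is void at \<open>t = 1\<close>, where \<open>\<Phi>\<^sub>1\<^sub>2(t,t) = 0\<close>.\<close>

definition riccati_bounds ::
  "(real \<Rightarrow> real \<Rightarrow> real^('n::finite + 'n)^('n + 'n)) \<Rightarrow> real \<Rightarrow> real^'n^'n \<Rightarrow> bool" where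
  "riccati_bounds \<Phi> t X \<longleftrightarrow>
     (t \<noteq> 0 \<longrightarrow> - (matrix_inv (blk12 (\<Phi> 0 t)) ** blk11 (\<Phi> 0 t)) \<prec>\<^sub>L X) \<and>
     (t \<noteq> 1 \<longrightarrow> X \<prec>\<^sub>L - (matrix_inv (blk12 (\<Phi> 1 t)) ** blk11 (\<Phi> 1 t)))"

end

theory Submission
  imports Defs
begin

text \<open>
  Write \<open>x' = A x - B B\<^sup>T y\<close>, \<open>y' = - Q x - A\<^sup>T y\<close> for the Hamiltonian system. The transition
  matrix supplies a trajectory for all initial data, and Gronwall's inequality makes it unique
  (\<open>linear_ode_zero\<close>). The graph of a Riccati solution is
  invariant under the flow, because the defect \<open>y - P x\<close> obeys a homogeneous linear equation. Hence
  \<open>P = Y X\<^sup>-\<^sup>1\<close> with \<open>X = \<Phi>\<^sub>1\<^sub>1 + \<Phi>\<^sub>1\<^sub>2 P0\<close>, \<open>Y = \<Phi>\<^sub>2\<^sub>1 + \<Phi>\<^sub>2\<^sub>2 P0\<close>, and a solution on \<open>[0,1]\<close> exists if and only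
  if \<open>X(t)\<close> is invertible for every \<open>t\<close> (\<open>riccati_flow\<close>, \<open>riccati_exists\<close>). It remains to match this
  with the two bounds.

  The key is the energy balance \<open>(x \<bullet> y)' = - (norm (B\<^sup>T y))\<^sup>2 - x \<bullet> Q x\<close>. Together with controllability it
  rules out nonzero trajectories that have \<open>x = 0\<close> twice, that is, it makes \<open>\<Phi>\<^sub>1\<^sub>2(T,s)\<close> invertible
  (\<open>blk12_invertible\<close>). So every \<open>v\<close> at time \<open>s\<close> can be steered to \<open>0\<close> at time \<open>T\<close> by exactly one
  trajectory; it starts with \<open>y = W v\<close>, where \<open>W = - \<Phi>\<^sub>1\<^sub>2(T,s)\<^sup>-\<^sup>1 \<Phi>\<^sub>1\<^sub>1(T,s)\<close> is the bound in question.

  If \<open>P\<close> solves the Riccati equation, completing the square along this trajectory gives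
  \<open>(x \<bullet> (y - P x))' = - (norm (B\<^sup>T (y - P x)))\<^sup>2\<close>, and integrating from \<open>s\<close> to \<open>T\<close> shows that
  \<open>v \<bullet> (W - P(s)) v\<close> has the sign of \<open>T - s\<close> for \<open>v \<noteq> 0\<close>, strictly by controllability (\<open>riccati_conj_bound\<close>).
  Conversely, if \<open>X(t) v = 0\<close> with \<open>t\<close> between \<open>s\<close> and \<open>T\<close>, then comparing the trajectory from
  \<open>(v, P0 v)\<close>, which has \<open>x(t) = 0\<close>, with the one steered to \<open>0\<close> at \<open>T\<close> contradicts the bound
  (\<open>flow_x_invertible_towards\<close>). The bounds at other times follow because a Riccati solution solves the
  problem with initial time \<open>t\<close> and value \<open>P(t)\<close> as well.
\<close>

section \<open>Matrix products as bounded bilinear maps\<close>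

text \<open>The default rewriting to \<open>v*\<close> would hide the adjoints, in terms of which everything below is
  stated.\<close>

declare transpose_matrix_vector [simp del] vector_transpose_matrix [simp del]

lemma bounded_bilinear_matrix_vector_mult:
  "bounded_bilinear ((*v) :: real^'n^'m \<Rightarrow> real^'n \<Rightarrow> real^'m)"
  unfolding bilinear_conv_bounded_bilinear[symmetric] bilinear_def linear_iff
  by (simp add: matrix_vector_mult_def vec_eq_iff algebra_simps sum.distrib sum_distrib_left)

lemma bounded_bilinear_matrix_matrix_mult:
  "bounded_bilinear ((**) :: real^'n^'m \<Rightarrow> real^'k^'n \<Rightarrow> real^'k^'m)"
  unfolding bilinear_conv_bounded_bilinear[symmetric] bilinear_def linear_iff
  by (simp add: matrix_matrix_mult_def vec_eq_iff algebra_simps sum.distrib sum_distrib_left)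

interpretation matvec: bounded_bilinear "(*v) :: real^'n^'m \<Rightarrow> real^'n \<Rightarrow> real^'m"
  by (rule bounded_bilinear_matrix_vector_mult)

interpretation matmat: bounded_bilinear "(**) :: real^'n^'m \<Rightarrow> real^'k^'n \<Rightarrow> real^'k^'m"
  by (rule bounded_bilinear_matrix_matrix_mult)

lemma bounded_linear_transpose: "bounded_linear (transpose :: real^'n^'m \<Rightarrow> real^'m^'n)"
  unfolding linear_conv_bounded_linear[symmetric] linear_iff
  by (simp add: transpose_def vec_eq_iff)

lemma inner_transpose_left: "(transpose X *v u) \<bullet> v = u \<bullet> (X *v v)"
  for X :: "real^'n^'m"
  by (simp add: transpose_matrix_vector dot_lmul_matrix)

lemma inner_transpose_right: "v \<bullet> (transpose X *v u) = (X *v v) \<bullet> u"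
  for X :: "real^'n^'m"
  by (metis inner_transpose_left inner_commute)

lemma inner_sym_matrix: "sym_matrix X \<Longrightarrow> (X *v u) \<bullet> v = u \<bullet> (X *v v)"
  by (metis inner_transpose_left sym_matrix_def)

lemma sym_matrix_iff_inner: "sym_matrix X \<longleftrightarrow> (\<forall>v w. v \<bullet> (X *v w) = w \<bullet> (X *v v))"
  for X :: "real^'m^'m"
proof
  assume "sym_matrix X"
  then show "\<forall>v w. v \<bullet> (X *v w) = w \<bullet> (X *v v)"
    by (metis inner_sym_matrix inner_commute)
next
  assume sym: "\<forall>v w. v \<bullet> (X *v w) = w \<bullet> (X *v v)"
  have "transpose X *v v = X *v v" for v
    by (rule vector_eq_rdot[THEN iffD1]) (metis inner_transpose_left inner_commute sym)
  then show "sym_matrix X"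
    unfolding sym_matrix_def matrix_eq by blast
qed

lemma transpose_matrix_mult: "transpose (X ** Y) = transpose Y ** transpose X"
  for X :: "real^'n^'m" and Y :: "real^'k^'n"
  by (rule matrix_transpose_mul)

lemma matrix_inv_inverse:
  fixes X :: "real^'n^'n"
  assumes "invertible X"
  shows "X ** matrix_inv X = mat 1" "matrix_inv X ** X = mat 1"
  using someI_ex[of "\<lambda>Y. X ** Y = mat 1 \<and> Y ** X = mat 1"] assms
  unfolding invertible_def matrix_inv_def by auto

lemma invertible_iff_kernel:
  fixes X :: "real^'n^'n"
  shows "invertible X \<longleftrightarrow> (\<forall>v. X *v v = 0 \<longrightarrow> v = 0)"
  by (simp add: invertible_left_inverse matrix_left_invertible_ker)

section \<open>Derivatives on an interval\<close>

lemma has_vector_derivative_continuous_on: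
  assumes "\<And>t. t \<in> S \<Longrightarrow> (f has_vector_derivative f' t) (at t within S)"
  shows "continuous_on S f"
  using assms by (meson continuous_on_eq_continuous_within has_vector_derivative_continuous)

lemma derivative_nonpos_imp_antimono:
  fixes h :: "real \<Rightarrow> real"
  assumes d: "\<And>t. t \<in> {a..b} \<Longrightarrow> (h has_vector_derivative h' t) (at t within {a..b})"
    and n: "\<And>t. t \<in> {a..b} \<Longrightarrow> h' t \<le> 0"
    and uv: "a \<le> u" "u \<le> v" "v \<le> b"
  shows "h v \<le> h u"
proof -
  have "\<exists>x\<in>{u..v}. h v - h u = (v - u) *\<^sub>R h' x"
  proof (rule mvt_very_simple[OF uv(2)])
    fix x assume "u \<le> x" "x \<le> v"
    then have "(h has_vector_derivative h' x) (at x within {u..v})"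
      using uv by (intro has_vector_derivative_within_subset[OF d]) auto
    then show "(h has_derivative (\<lambda>k. k *\<^sub>R h' x)) (at x within {u..v})"
      by (simp add: has_vector_derivative_def)
  qed
  then obtain x where x: "x \<in> {u..v}" "h v - h u = (v - u) * h' x" by auto
  have "(v - u) * h' x \<le> 0"
    using n[of x] x uv by (intro mult_nonneg_nonpos) auto
  then show ?thesis using x by simp
qed

lemma derivative_zero_imp_const:
  fixes h :: "real \<Rightarrow> real"
  assumes d: "\<And>t. t \<in> {a..b} \<Longrightarrow> (h has_vector_derivative 0) (at t within {a..b})"
    and "u \<in> {a..b}" "v \<in> {a..b}"
  shows "h u = h v"
proof -
  have "h v \<le> h u \<and> h u \<le> h v" if "u \<in> {a..b}" "v \<in> {a..b}" "u \<le> v" for u v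
  proof -
    have "- h v \<le> - h u"
      using that by (intro derivative_nonpos_imp_antimono[of a b "\<lambda>t. - h t" "\<lambda>_. - 0"]
          has_vector_derivative_minus d) auto
    then show ?thesis
      using derivative_nonpos_imp_antimono[of a b h "\<lambda>_. 0", OF d] that by auto
  qed
  then show ?thesis
    using assms(2,3) by (meson linear order_antisym)
qed

text \<open>The dissipation inequality in both time directions at once: the factor \<^term>\<open>v - u\<close> carries
  the orientation, so that the two endpoints of the time interval can be treated together.\<close>

lemma dissipation_oriented:
  fixes h :: "real \<Rightarrow> real"
  assumes d: "\<And>t. t \<in> {0..1} \<Longrightarrow> (h has_vector_derivative - c t) (at t within {0..1})"
    and c: "\<And>t. t \<in> {0..1} \<Longrightarrow> 0 \<le> c t"
    and uv: "u \<in> {0..1}" "v \<in> {0..1}"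
  shows "0 \<le> (v - u) * (h u - h v)"
proof (cases "u \<le> v")
  case True
  then have "h v \<le> h u"
    using derivative_nonpos_imp_antimono[OF d, of u v] c uv by auto
  then show ?thesis using True by simp
next
  case False
  then have "h u \<le> h v"
    using derivative_nonpos_imp_antimono[OF d, of v u] c uv by auto
  then show ?thesis using False by (simp add: mult_nonpos_nonpos)
qed

text \<open>A monotone function with equal values at the ends of an interval is constant there, so its
  derivative vanishes, also one-sidedly at the ends.\<close>

lemma no_dissipation:
  fixes h :: "real \<Rightarrow> real"
  assumes d: "\<And>t. t \<in> {0..1} \<Longrightarrow> (h has_vector_derivative - c t) (at t within {0..1})"
    and c: "\<And>t. t \<in> {0..1} \<Longrightarrow> 0 \<le> c t"
    and ab: "0 \<le> a" "a < b" "b \<le> 1" and eq: "h a = h b" and t: "t \<in> {a..b}"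
  shows "c t = 0"
proof -
  have "h x = h a" if "x \<in> {a..b}" for x
  proof (rule antisym)
    show "h x \<le> h a"
      using c ab that by (intro derivative_nonpos_imp_antimono[OF d]) auto
    have "h b \<le> h x"
      using c ab that by (intro derivative_nonpos_imp_antimono[OF d]) auto
    then show "h a \<le> h x" by (simp add: eq)
  qed
  then have "(h has_vector_derivative 0) (at t within {a..b})"
    by (rule has_vector_derivative_transform[OF t _ has_vector_derivative_const])
  moreover have "(h has_vector_derivative - c t) (at t within {a..b})"
    using ab t by (intro has_vector_derivative_within_subset[OF d]) auto
  ultimately show ?thesis
    using vector_derivative_unique_within_closed_interval[of a b t h 0 "- c t"] ab t
    by (simp add: cbox_interval)
qed

text \<open>Gronwall's argument: with \<open>K\<close> the growth rate, \<open>exp (- 2 K t) * (z t \<bullet> z t)\<close> does not increase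
  and \<open>exp (2 K t) * (z t \<bullet> z t)\<close> does not decrease.\<close>

lemma gronwall_zero:
  fixes z :: "real \<Rightarrow> 'a::real_inner"
  assumes d: "\<And>t. t \<in> {a..b} \<Longrightarrow> (z has_vector_derivative z' t) (at t within {a..b})"
    and K: "\<And>t. t \<in> {a..b} \<Longrightarrow> norm (z' t) \<le> K * norm (z t)"
    and s: "s \<in> {a..b}" "z s = 0" and t: "t \<in> {a..b}"
  shows "z t = 0"
proof -
  define q where "q t = z t \<bullet> z t" for t
  have q0: "0 \<le> q t" for t by (simp add: q_def)
  have bd: "\<bar>z t \<bullet> z' t\<bar> \<le> K * q t" if "t \<in> {a..b}" for t
  proof -
    have "\<bar>z t \<bullet> z' t\<bar> \<le> norm (z t) * norm (z' t)" by (rule Cauchy_Schwarz_ineq2)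
    also have "\<dots> \<le> norm (z t) * (K * norm (z t))"
      using K[OF that] by (intro mult_left_mono) auto
    finally show ?thesis by (simp add: q_def dot_square_norm power2_eq_square mult_ac)
  qed
  have dq: "(q has_vector_derivative 2 * (z t \<bullet> z' t)) (at t within {a..b})" if "t \<in> {a..b}" for t
    unfolding q_def using bounded_bilinear.has_vector_derivative[OF bounded_bilinear_inner d[OF that] d[OF that]]
    by (simp add: inner_commute)
  have de: "((\<lambda>t. exp (L * t) * q t) has_vector_derivative
      exp (L * t) * (2 * (z t \<bullet> z' t)) + (exp (L * t) * L) * q t) (at t within {a..b})"
    if "t \<in> {a..b}" for t L
  proof (rule has_vector_derivative_mult[OF _ dq[OF that]])
    have "((\<lambda>t. exp (L * t)) has_real_derivative exp (L * t) * L) (at t within {a..b})"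
      by (auto intro!: derivative_eq_intros)
    then show "((\<lambda>t. exp (L * t)) has_vector_derivative exp (L * t) * L) (at t within {a..b})"
      by (simp add: has_real_derivative_iff_has_vector_derivative)
  qed
  have neg: "exp (L * t) * (2 * (z t \<bullet> z' t)) + (exp (L * t) * L) * q t \<le> 0"
    if "t \<in> {a..b}" "L = - 2 * K" for t L
  proof -
    have "exp (L * t) * (2 * (z t \<bullet> z' t) + L * q t) \<le> 0"
      using bd[OF that(1)] that(2) by (intro mult_nonneg_nonpos) auto
    then show ?thesis by (simp add: algebra_simps)
  qed
  have pos: "0 \<le> exp (L * t) * (2 * (z t \<bullet> z' t)) + (exp (L * t) * L) * q t"
    if "t \<in> {a..b}" "L = 2 * K" for t L
  proof -
    have "0 \<le> exp (L * t) * (2 * (z t \<bullet> z' t) + L * q t)"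
      using bd[OF that(1)] that(2) by (intro mult_nonneg_nonneg) auto
    then show ?thesis by (simp add: algebra_simps)
  qed
  have "q t \<le> 0"
  proof (cases "s \<le> t")
    case True
    have "exp (- 2 * K * t) * q t \<le> exp (- 2 * K * s) * q s"
      using derivative_nonpos_imp_antimono[OF de[of _ "- 2 * K"] neg] True s t by auto
    then show ?thesis using s by (simp add: q_def mult_le_0_iff)
  next
    case False
    define h where "h r = - (exp (2 * K * r) * q r)" for r
    define h' where "h' r = - (exp (2 * K * r) * (2 * (z r \<bullet> z' r)) + (exp (2 * K * r) * (2 * K)) * q r)" for r
    have "(h has_vector_derivative h' r) (at r within {a..b})" if "r \<in> {a..b}" for r
      unfolding h_def h'_def by (rule has_vector_derivative_minus[OF de[OF that]])
    moreover have "h' r \<le> 0" if "r \<in> {a..b}" for r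
      unfolding h'_def neg_le_0_iff_le by (rule pos[OF that refl])
    ultimately have "h s \<le> h t"
      using False s(1) t by (intro derivative_nonpos_imp_antimono[of a b h h' t s]) auto
    then have "exp (2 * K * t) * q t \<le> exp (2 * K * s) * q s"
      by (simp add: h_def)
    then show ?thesis using s by (simp add: q_def mult_le_0_iff)
  qed
  then show ?thesis
    unfolding q_def using inner_gt_zero_iff[of "z t"] by linarith
qed

lemma matrix_family_bounded:
  fixes M :: "real \<Rightarrow> real^'n^'m"
  assumes "continuous_on {a..b} M"
  obtains K where "0 \<le> K" "\<And>t v. t \<in> {a..b} \<Longrightarrow> norm (M t *v v) \<le> K * norm v"
proof -
  obtain C where C: "C \<ge> 0" "\<And>X v. norm ((X::real^'n^'m) *v v) \<le> norm X * norm v * C"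
    using matvec.nonneg_bounded by blast
  have "bounded (M ` {a..b})"
    by (intro compact_imp_bounded compact_continuous_image assms compact_Icc)
  then obtain N where N: "N > 0" "\<And>t. t \<in> {a..b} \<Longrightarrow> norm (M t) \<le> N"
    by (auto simp: bounded_pos)
  show thesis
  proof (rule that[of "N * C"])
    show "0 \<le> N * C" using N C by simp
    fix t v assume t: "t \<in> {a..b}"
    have "norm (M t *v v) \<le> norm (M t) * norm v * C" by (rule C(2))
    also have "\<dots> \<le> N * norm v * C"
      using N(2)[OF t] C(1) by (intro mult_right_mono) auto
    finally show "norm (M t *v v) \<le> N * C * norm v" by (simp add: mult_ac)
  qed
qed

lemma linear_ode_zero:
  fixes z :: "real \<Rightarrow> real^'n"
  assumes "continuous_on {a..b} M"
    and "\<And>t. t \<in> {a..b} \<Longrightarrow> (z has_vector_derivative M t *v z t) (at t within {a..b})"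
    and "s \<in> {a..b}" "z s = 0" "t \<in> {a..b}"
  shows "z t = 0"
proof -
  obtain K where "\<And>t v. t \<in> {a..b} \<Longrightarrow> norm (M t *v v) \<le> K * norm v"
    using matrix_family_bounded[OF assms(1)] by metis
  then show ?thesis
    using gronwall_zero[where z' = "\<lambda>t. M t *v z t" and K = K, OF assms(2) _ assms(3-5)] by simp
qed

section \<open>The derivative of the inverse of a matrix\<close>

lemma has_vector_derivative_iff_quotient:
  fixes f :: "real \<Rightarrow> 'a::real_normed_vector"
  shows "(f has_vector_derivative f') (at x within S) \<longleftrightarrow>
    ((\<lambda>y. (f y - f x) /\<^sub>R (y - x)) \<longlongrightarrow> f') (at x within S)"
proof -
  have q: "norm ((f y - f x) /\<^sub>R (y - x) - f') = norm ((f y - f x) - (y - x) *\<^sub>R f') / norm (y - x)"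
    if "y \<noteq> x" for y
  proof -
    have "(f y - f x) /\<^sub>R (y - x) - f' = ((f y - f x) - (y - x) *\<^sub>R f') /\<^sub>R (y - x)"
      using that by (simp add: scaleR_diff_right)
    then show ?thesis by (simp add: divide_inverse mult.commute)
  qed
  have "(f has_vector_derivative f') (at x within S) \<longleftrightarrow>
      ((\<lambda>y. norm ((f y - f x) - (y - x) *\<^sub>R f') / norm (y - x)) \<longlongrightarrow> 0) (at x within S)"
    by (simp add: has_vector_derivative_def has_derivative_iff_norm bounded_linear_scaleR_left)
  also have "\<dots> \<longleftrightarrow> ((\<lambda>y. norm ((f y - f x) /\<^sub>R (y - x) - f')) \<longlongrightarrow> 0) (at x within S)"
    by (rule Lim_cong_within) (simp_all add: q)
  also have "\<dots> \<longleftrightarrow> ((\<lambda>y. (f y - f x) /\<^sub>R (y - x) - f') \<longlongrightarrow> 0) (at x within S)"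
    by (rule tendsto_norm_zero_iff)
  also have "\<dots> \<longleftrightarrow> ((\<lambda>y. (f y - f x) /\<^sub>R (y - x)) \<longlongrightarrow> f') (at x within S)"
    by (rule LIM_zero_iff)
  finally show ?thesis .
qed

lemma continuous_on_det:
  fixes X :: "'a::topological_space \<Rightarrow> real^'n^'n"
  assumes "continuous_on S X"
  shows "continuous_on S (\<lambda>t. det (X t))"
  unfolding det_def using assms by (intro continuous_intros)

text \<open>Cramer's rule exhibits the entries of the inverse as quotients of determinants.\<close>

lemma continuous_on_matrix_inv:
  fixes X :: "'a::topological_space \<Rightarrow> real^'n^'n"
  assumes c: "continuous_on S X" and inv: "\<And>t. t \<in> S \<Longrightarrow> invertible (X t)"
  shows "continuous_on S (\<lambda>t. matrix_inv (X t))"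
proof -
  define C where "C t = (\<chi> k l. det (\<chi> i j. if j = k then axis l 1 $ i else X t $ i $ j) / det (X t) :: real^'n^'n)" for t
  have "matrix_inv (X t) = C t" if "t \<in> S" for t
  proof -
    have d: "det (X t) \<noteq> 0" using inv[OF that] by (simp add: invertible_det_nz)
    have "X t *v (matrix_inv (X t) *v axis l 1) = axis l 1" for l
      by (simp add: matrix_vector_mul_assoc matrix_inv_inverse[OF inv[OF that]])
    then have "matrix_inv (X t) *v axis l 1 =
        (\<chi> k. det (\<chi> i j. if j = k then axis l 1 $ i else X t $ i $ j) / det (X t))" for l
      using cramer[OF d] by blast
    then have "matrix_inv (X t) $ k $ l = C t $ k $ l" for k l
      by (metis (no_types, lifting) C_def column_def matrix_vector_mult_basis vec_lambda_beta)
    then show ?thesis by (simp add: vec_eq_iff)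
  qed
  moreover have "continuous_on S C"
    unfolding C_def
  proof (intro continuous_on_vec_lambda continuous_on_divide continuous_on_det c)
    fix k l i j :: 'n
    show "continuous_on S (\<lambda>t. if j = k then axis l 1 $ i else X t $ i $ j)"
      using c by (cases "j = k") (auto intro!: continuous_intros)
  next
    show "\<forall>t\<in>S. det (X t) \<noteq> 0" using inv by (simp add: invertible_det_nz)
  qed
  ultimately show ?thesis by (simp cong: continuous_on_cong)
qed

text \<open>With \<open>Y\<close> the inverse of \<open>X\<close>, the difference quotient of \<open>Y\<close> is
  \<open>- Y u ** ((X u - X t) /\<^sub>R (u - t)) ** Y t\<close>, so continuity of \<open>Y\<close> suffices to pass to the limit.\<close>

lemma has_vector_derivative_matrix_inv:
  fixes X :: "real \<Rightarrow> real^'n^'n"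
  assumes d: "\<And>t. t \<in> S \<Longrightarrow> (X has_vector_derivative X' t) (at t within S)"
    and inv: "\<And>t. t \<in> S \<Longrightarrow> invertible (X t)" and t: "t \<in> S"
  shows "((\<lambda>t. matrix_inv (X t)) has_vector_derivative
    - (matrix_inv (X t) ** X' t ** matrix_inv (X t))) (at t within S)"
proof -
  define Y where "Y t = matrix_inv (X t)" for t
  have Y: "X t ** Y t = mat 1" "Y t ** X t = mat 1" if "t \<in> S" for t
    using matrix_inv_inverse[OF inv[OF that]] by (auto simp: Y_def)
  have "(Y \<longlongrightarrow> Y t) (at t within S)"
    using continuous_on_matrix_inv[OF has_vector_derivative_continuous_on[OF d] inv] t
    unfolding Y_def continuous_on_def by blast
  then have lim: "((\<lambda>u. - (Y u ** ((X u - X t) /\<^sub>R (u - t)) ** Y t)) \<longlongrightarrow> - (Y t ** X' t ** Y t)) (at t within S)"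
    using d[OF t] unfolding has_vector_derivative_iff_quotient
    by (intro tendsto_minus matmat.tendsto tendsto_const)
  have "- (Y u ** ((X u - X t) /\<^sub>R (u - t)) ** Y t) = (Y u - Y t) /\<^sub>R (u - t)"
    if "u \<in> S" for u
  proof -
    have "Y u ** (X u - X t) ** Y t = Y t - Y u"
      by (simp add: matmat.diff_left matmat.diff_right Y[OF that] Y[OF t] matrix_mul_assoc[symmetric])
    then have "Y u ** ((X u - X t) /\<^sub>R (u - t)) ** Y t = (Y t - Y u) /\<^sub>R (u - t)"
      by (simp only: matmat.scaleR_left matmat.scaleR_right)
    then show ?thesis
      by (simp only: scaleR_minus_right[symmetric] minus_diff_eq)
  qed
  then have ev: "\<forall>\<^sub>F u in at t within S.
      - (Y u ** ((X u - X t) /\<^sub>R (u - t)) ** Y t) = (Y u - Y t) /\<^sub>R (u - t)"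
    by (simp add: eventually_at_filter)
  have "((\<lambda>u. (Y u - Y t) /\<^sub>R (u - t)) \<longlongrightarrow> - (Y t ** X' t ** Y t)) (at t within S)"
    by (rule Lim_transform_eventually[OF lim ev])
  then show ?thesis
    unfolding has_vector_derivative_iff_quotient Y_def .
qed

section \<open>Functions of class \<open>C\<^sup>k\<close>\<close>

lemma Ck_on_cong:
  assumes "\<And>t. t \<in> S \<Longrightarrow> f t = g t"
  shows "Ck_on k f S \<longleftrightarrow> Ck_on k g S"
  using assms
proof (induction k arbitrary: f g)
  case 0
  then show ?case by (simp cong: continuous_on_cong)
next
  case (Suc k)
  have e: "(f has_vector_derivative D) (at t within S) \<longleftrightarrow> (g has_vector_derivative D) (at t within S)"
    if "t \<in> S" for t D
  proof
    assume "(f has_vector_derivative D) (at t within S)"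
    then show "(g has_vector_derivative D) (at t within S)"
      by (rule has_vector_derivative_transform[OF that, rotated]) (simp add: Suc.prems)
  next
    assume "(g has_vector_derivative D) (at t within S)"
    then show "(f has_vector_derivative D) (at t within S)"
      by (rule has_vector_derivative_transform[OF that, rotated]) (simp add: Suc.prems)
  qed
  have "f differentiable at t within S \<longleftrightarrow> g differentiable at t within S" if "t \<in> S" for t
    using e[OF that] vector_derivative_works differentiableI_vector by metis
  moreover have "vector_derivative f (at t within S) = vector_derivative g (at t within S)"
    if "t \<in> S" for t
    using e[OF that] by (simp add: vector_derivative_def)
  ultimately show ?case
    using Suc.IH[of "\<lambda>t. vector_derivative f (at t within S)" "\<lambda>t. vector_derivative g (at t within S)"]
    by auto
qed

lemma Ck_on_SucI:
  assumes d: "\<And>t. t \<in> {0..1} \<Longrightarrow> (f has_vector_derivative f' t) (at t within {0..1})"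
    and "Ck_on k f' {0..1}"
  shows "Ck_on (Suc k) f {0..1}"
proof -
  have "vector_derivative f (at t within {0..1}) = f' t" if "t \<in> {0..1}" for t
    using vector_derivative_within_cbox[of 0 1 t f "f' t"] d[OF that] that by (simp add: cbox_interval)
  then have "Ck_on k (\<lambda>t. vector_derivative f (at t within {0..1})) {0..1}"
    using Ck_on_cong[of "{0..1}" "\<lambda>t. vector_derivative f (at t within {0..1})" f' k] assms(2) by simp
  then show ?thesis
    using differentiableI_vector[OF d] by simp
qed

lemma Ck_on_SucD:
  assumes "Ck_on (Suc k) f S" "t \<in> S"
  shows "(f has_vector_derivative vector_derivative f (at t within S)) (at t within S)"
  using assms by (simp add: vector_derivative_works)

lemma Ck_on_Suc_imp: "Ck_on (Suc k) f S \<Longrightarrow> Ck_on k f S"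
proof (induction k arbitrary: f)
  case 0
  then show ?case
    using has_vector_derivative_continuous_on[OF Ck_on_SucD[OF 0]] by simp
next
  case (Suc k)
  have "Ck_on (Suc k) (\<lambda>t. vector_derivative f (at t within S)) S"
    using Suc.prems by (subst (asm) Ck_on.simps(2)) blast
  then have "Ck_on k (\<lambda>t. vector_derivative f (at t within S)) S"
    by (rule Suc.IH)
  then show ?case using Suc.prems by simp
qed

lemma Ck_on_le: "Ck_on k f S \<Longrightarrow> j \<le> k \<Longrightarrow> Ck_on j f S"
  by (induction k) (auto simp del: Ck_on.simps simp: le_Suc_eq dest: Ck_on_Suc_imp)

lemma Ck_on_imp_continuous_on: "Ck_on k f S \<Longrightarrow> continuous_on S f"
  using Ck_on_le[of k f S 0] by simp

lemma Ck_on_add: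
  "Ck_on k f {0..1} \<Longrightarrow> Ck_on k g {0..1} \<Longrightarrow> Ck_on k (\<lambda>t. f t + g t) {0..1}"
proof (induction k arbitrary: f g)
  case 0
  then show ?case by (auto intro: continuous_on_add)
next
  case (Suc k)
  show ?case
  proof (rule Ck_on_SucI)
    show "Ck_on k (\<lambda>t. vector_derivative f (at t within {0..1}) + vector_derivative g (at t within {0..1})) {0..1}"
      using Suc.prems by (intro Suc.IH) auto
  qed (rule has_vector_derivative_add[OF Ck_on_SucD[OF Suc.prems(1)] Ck_on_SucD[OF Suc.prems(2)]])
qed

lemma (in bounded_linear) Ck_on: "Ck_on k g {0..1} \<Longrightarrow> Ck_on k (\<lambda>t. f (g t)) {0..1}"
proof (induction k arbitrary: g)
  case 0
  then show ?case using continuous_on[of "{0..1}" g] by simp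
next
  case (Suc k)
  have "Ck_on k (\<lambda>t. vector_derivative g (at t within {0..1})) {0..1}"
    using Suc.prems by simp
  then have "Ck_on k (\<lambda>t. f (vector_derivative g (at t within {0..1}))) {0..1}"
    by (rule Suc.IH)
  show ?case
  proof (rule Ck_on_SucI)
    show "Ck_on k (\<lambda>t. f (vector_derivative g (at t within {0..1}))) {0..1}" by fact
    fix t :: real assume "t \<in> {0..1}"
    from has_vector_derivative[OF Ck_on_SucD[OF Suc.prems this]]
    show "((\<lambda>t. f (g t)) has_vector_derivative f (vector_derivative g (at t within {0..1}))) (at t within {0..1})" .
  qed
qed

lemmas Ck_on_minus = bounded_linear.Ck_on[OF bounded_linear_minus[OF bounded_linear_ident]]

lemma (in bounded_bilinear) Ck_on:
  "Ck_on k f {0..1} \<Longrightarrow> Ck_on k g {0..1} \<Longrightarrow> Ck_on k (\<lambda>t. prod (f t) (g t)) {0..1}"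
proof (induction k arbitrary: f g)
  case 0
  then show ?case using continuous_on[of "{0..1}" f g] by simp
next
  case (Suc k)
  have f: "Ck_on k f {0..1}" and g: "Ck_on k g {0..1}"
    using Suc.prems by (auto simp del: Ck_on.simps intro: Ck_on_Suc_imp)
  show ?case
  proof (rule Ck_on_SucI)
    show "Ck_on k (\<lambda>t. prod (f t) (vector_derivative g (at t within {0..1})) +
        prod (vector_derivative f (at t within {0..1})) (g t)) {0..1}"
      using Suc.prems f g by (intro Ck_on_add Suc.IH) auto
  qed (rule has_vector_derivative[OF Ck_on_SucD[OF Suc.prems(1)] Ck_on_SucD[OF Suc.prems(2)]])
qed

text \<open>Each step of the recursion costs one derivative: with \<open>A\<close> in \<open>C\<^sup>m\<close> and \<open>B\<close> one class better, the
  supply lasts up to \<open>\<Gamma>\<^sub>m\<^sub>+\<^sub>1\<close>, which is merely continuous.\<close>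

lemma Ck_on_Gam:
  fixes A :: "real \<Rightarrow> real^'n^'n" and B :: "real \<Rightarrow> real^'p^'n"
  assumes A: "Ck_on m A {0..1}" and B: "Ck_on (Suc m) B {0..1}"
  shows "k \<le> Suc m \<Longrightarrow> Ck_on (Suc m - k) (Gam A B k) {0..1}"
proof (induction k)
  case 0
  then show ?case using B by simp
next
  case (Suc k)
  then have e: "Suc m - k = Suc (m - k)" by simp
  have G: "Ck_on (Suc (m - k)) (Gam A B k) {0..1}"
    using Suc unfolding e by simp
  have "Ck_on (m - k) A {0..1}" by (rule Ck_on_le[OF A]) simp
  then have "Ck_on (m - k) (\<lambda>t. - (A t ** Gam A B k t)) {0..1}"
    by (rule Ck_on_minus[OF matmat.Ck_on[OF _ Ck_on_Suc_imp[OF G]]])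
  moreover have "Ck_on (m - k) (\<lambda>t. vector_derivative (Gam A B k) (at t within {0..1})) {0..1}"
    using G by simp
  ultimately have "Ck_on (m - k) (\<lambda>t. - (A t ** Gam A B k t) + vector_derivative (Gam A B k) (at t within {0..1})) {0..1}"
    by (rule Ck_on_add)
  then show ?case by simp
qed

section \<open>Controllability and the adjoint equation\<close>

lemma transpose_add: "transpose (X + Y) = transpose X + transpose Y"
  and transpose_diff: "transpose (X - Y) = transpose X - transpose Y"
  and transpose_minus: "transpose (- X) = - transpose X"
  for X Y :: "real^'n^'m"
  by (simp_all add: transpose_def vec_eq_iff)

text \<open>The \<open>\<Gamma>\<^sub>k\<close> are made for this: \<open>\<Gamma>\<^sub>k\<^sub>+\<^sub>1\<^sup>T y\<close> is the derivative of \<open>\<Gamma>\<^sub>k\<^sup>T y\<close> along \<open>y' = - A\<^sup>T y\<close>.\<close>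

lemma adjoint_annihilates_Gam:
  fixes A :: "real \<Rightarrow> real^'n^'n" and B :: "real \<Rightarrow> real^'p^'n"
  assumes A: "Ck_on m A {0..1}" and B: "Ck_on (Suc m) B {0..1}"
    and ab: "0 \<le> a" "a < b" "b \<le> 1"
    and y: "\<And>t. t \<in> {a..b} \<Longrightarrow>
      (y has_vector_derivative - (transpose (A t) *v y t)) (at t within {a..b})"
    and By: "\<And>t. t \<in> {a..b} \<Longrightarrow> transpose (B t) *v y t = 0"
  shows "k \<le> m \<Longrightarrow> t \<in> {a..b} \<Longrightarrow> transpose (Gam A B k t) *v y t = 0"
proof (induction k arbitrary: t)
  case 0
  then show ?case using By by simp
next
  case (Suc k)
  let ?G = "Gam A B k"
  let ?G' = "vector_derivative ?G (at t within {0..1})"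
  have "Ck_on (Suc m - k) ?G {0..1}"
    using Ck_on_Gam[OF A B, of k] Suc.prems by simp
  then have "Ck_on (Suc (m - k)) ?G {0..1}"
    using Suc.prems by (simp only: Suc_diff_le Suc_leD)
  then have "(?G has_vector_derivative ?G') (at t within {0..1})"
    using Suc.prems ab by (intro Ck_on_SucD) auto
  then have "(?G has_vector_derivative ?G') (at t within {a..b})"
    using ab by (auto elim: has_vector_derivative_within_subset)
  then have "((\<lambda>t. transpose (?G t)) has_vector_derivative transpose ?G') (at t within {a..b})"
    by (rule bounded_linear.has_vector_derivative[OF bounded_linear_transpose])
  from matvec.has_vector_derivative[OF this y[OF Suc.prems(2)]]
  have "((\<lambda>t. transpose (?G t) *v y t) has_vector_derivative
      transpose (Gam A B (Suc k) t) *v y t) (at t within {a..b})"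
    by (simp add: transpose_diff transpose_matrix_mult matvec.diff_left
        matvec.minus_right matrix_vector_mul_assoc)
  moreover have "((\<lambda>t. transpose (?G t) *v y t) has_vector_derivative 0) (at t within {a..b})"
    by (rule has_vector_derivative_transform[OF Suc.prems(2) _ has_vector_derivative_const])
       (use Suc in auto)
  ultimately show ?case
    using vector_derivative_unique_within_closed_interval[of a b t] ab Suc.prems(2)
    by (metis box_real(2))
qed

text \<open>Total controllability in its dual form: an adjoint trajectory is observable through \<open>B\<^sup>T\<close> on any
  short interval. At a time of full rank in
  the interval, \<open>y\<close> is orthogonal to the columns of all the \<open>\<Gamma>\<^sub>k\<close> with \<open>k < n\<close>, so it vanishes there and by
  uniqueness on the whole interval.\<close>

lemma controllable_adjoint_zero:
  fixes A :: "real \<Rightarrow> real^'n^'n" and B :: "real \<Rightarrow> real^'p^'n"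
  assumes A: "Ck_on (CARD('n) - 1) A {0..1}" and B: "Ck_on CARD('n) B {0..1}"
    and tc: "totally_controllable A B"
    and ab: "0 \<le> a" "a < b" "b \<le> 1"
    and y: "\<And>t. t \<in> {a..b} \<Longrightarrow>
      (y has_vector_derivative - (transpose (A t) *v y t)) (at t within {a..b})"
    and By: "\<And>t. t \<in> {a..b} \<Longrightarrow> transpose (B t) *v y t = 0"
    and t: "t \<in> {a..b}"
  shows "y t = 0"
proof -
  have B': "Ck_on (Suc (CARD('n) - 1)) B {0..1}" using B by simp
  obtain r where r: "r \<in> {a<..<b}" "rank (Theta A B r) = CARD('n)"
    using tc ab unfolding totally_controllable_def by blast
  have "(transpose (Theta A B r) *v y r) $ c = 0" for c :: "'n \<times> 'p"
  proof -
    let ?k = "to_nat_on (UNIV :: 'n set) (fst c)"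
    have k: "?k < CARD('n)"
      using to_nat_on_finite[of "UNIV :: 'n set"] by (auto simp: bij_betw_def)
    have "transpose (Gam A B ?k r) *v y r = 0"
      by (rule adjoint_annihilates_Gam[OF A B' ab y By]) (use k r(1) in auto)
    moreover have "(transpose (Theta A B r) *v y r) $ c = (transpose (Gam A B ?k r) *v y r) $ snd c"
      by (simp add: matrix_vector_mult_def transpose_def Theta_def)
    ultimately show ?thesis by simp
  qed
  then have z: "transpose (Theta A B r) *v y r = 0" by (simp add: vec_eq_iff)
  obtain w where w: "y r = Theta A B r *v w"
    using r(2) unfolding full_rank_surjective by (metis surjD)
  have "y r \<bullet> y r = (transpose (Theta A B r) *v y r) \<bullet> w"
    unfolding inner_transpose_left by (simp flip: w)
  then have y0: "y r = 0" by (simp add: z)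
  have cA: "continuous_on {a..b} (\<lambda>t. - transpose (A t))"
    using ab by (intro continuous_on_minus bounded_linear.continuous_on[OF bounded_linear_transpose]
        continuous_on_subset[OF Ck_on_imp_continuous_on[OF A]]) auto
  show ?thesis
    using linear_ode_zero[of a b "\<lambda>t. - transpose (A t)" y r t] cA y y0 r(1) t
    by (simp add: matvec.minus_left)
qed

section \<open>Hamiltonian trajectories\<close>

definition ham_traj ::
  "(real \<Rightarrow> real^'n^'n) \<Rightarrow> (real \<Rightarrow> real^'p^'n) \<Rightarrow> (real \<Rightarrow> real^'n^'n)
     \<Rightarrow> (real \<Rightarrow> real^'n) \<Rightarrow> (real \<Rightarrow> real^'n) \<Rightarrow> bool" where
  "ham_traj A B Q x y \<longleftrightarrow> (\<forall>t\<in>{0..1}.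
     (x has_vector_derivative A t *v x t - B t *v (transpose (B t) *v y t)) (at t within {0..1}) \<and>
     (y has_vector_derivative - (Q t *v x t) - transpose (A t) *v y t) (at t within {0..1}))"

lemma ham_trajD:
  assumes "ham_traj A B Q x y" "t \<in> {0..1}"
  shows "(x has_vector_derivative A t *v x t - B t *v (transpose (B t) *v y t)) (at t within {0..1})"
    and "(y has_vector_derivative - (Q t *v x t) - transpose (A t) *v y t) (at t within {0..1})"
  using assms by (simp_all add: ham_traj_def)

lemma ham_traj_diff:
  assumes "ham_traj A B Q x y" "ham_traj A B Q u w"
  shows "ham_traj A B Q (\<lambda>t. x t - u t) (\<lambda>t. y t - w t)"
  unfolding ham_traj_def
proof (intro ballI conjI)
  fix t :: real assume t: "t \<in> {0..1}"
  from has_vector_derivative_diff[OF ham_trajD(1)[OF assms(1) t] ham_trajD(1)[OF assms(2) t]]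
  show "((\<lambda>t. x t - u t) has_vector_derivative
      A t *v (x t - u t) - B t *v (transpose (B t) *v (y t - w t))) (at t within {0..1})"
    by (simp add: matvec.diff_right algebra_simps)
  from has_vector_derivative_diff[OF ham_trajD(2)[OF assms(1) t] ham_trajD(2)[OF assms(2) t]]
  show "((\<lambda>t. y t - w t) has_vector_derivative
      - (Q t *v (x t - u t)) - transpose (A t) *v (y t - w t)) (at t within {0..1})"
    by (simp add: matvec.diff_right algebra_simps)
qed

text \<open>For \<open>u = x\<close> and \<open>w = y\<close> this is the energy balance; the difference of two such pairings shows
  that the symplectic form is conserved.\<close>

lemma ham_traj_pairing:
  assumes "ham_traj A B Q x y" "ham_traj A B Q u w" "t \<in> {0..1}"
  shows "((\<lambda>t. x t \<bullet> w t) has_vector_derivative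
    - ((transpose (B t) *v y t) \<bullet> (transpose (B t) *v w t) + x t \<bullet> (Q t *v u t))) (at t within {0..1})"
proof -
  have "x t \<bullet> (- (Q t *v u t) - transpose (A t) *v w t)
      + (A t *v x t - B t *v (transpose (B t) *v y t)) \<bullet> w t
    = - ((transpose (B t) *v y t) \<bullet> (transpose (B t) *v w t) + x t \<bullet> (Q t *v u t))"
    by (simp add: inner_diff_left inner_diff_right inner_transpose_right)
  then show ?thesis
    using bounded_bilinear.has_vector_derivative[OF bounded_bilinear_inner
        ham_trajD(1)[OF assms(1,3)] ham_trajD(2)[OF assms(2,3)]] by simp
qed

section \<open>Blocks of the transition matrix\<close>

lemma sum_UNIV_Plus: "(\<Sum>k\<in>UNIV. f k) = (\<Sum>a\<in>UNIV. f (Inl a)) + (\<Sum>b\<in>UNIV. f (Inr b))"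
  for f :: "'a::finite + 'b::finite \<Rightarrow> real"
  using sum.Plus[of "UNIV :: 'a set" "UNIV :: 'b set" f] by (simp add: comp_def)

lemma blk_block_mat_mult:
  "blk11 (block_mat M11 M12 M21 M22 ** X) = M11 ** blk11 X + M12 ** blk21 X"
  "blk12 (block_mat M11 M12 M21 M22 ** X) = M11 ** blk12 X + M12 ** blk22 X"
  "blk21 (block_mat M11 M12 M21 M22 ** X) = M21 ** blk11 X + M22 ** blk21 X"
  "blk22 (block_mat M11 M12 M21 M22 ** X) = M21 ** blk12 X + M22 ** blk22 X"
  by (simp_all add: blk11_def blk12_def blk21_def blk22_def block_mat_def matrix_matrix_mult_def
      vec_eq_iff sum_UNIV_Plus)

lemma blk_mat_1:
  "blk11 (mat 1) = mat 1" "blk12 (mat 1) = 0" "blk21 (mat 1) = 0" "blk22 (mat 1) = mat 1"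
  by (simp_all add: blk11_def blk12_def blk21_def blk22_def mat_def vec_eq_iff)

lemma bounded_linear_blk:
  "bounded_linear blk11" "bounded_linear blk12" "bounded_linear blk21" "bounded_linear blk22"
  unfolding linear_conv_bounded_linear[symmetric] linear_iff
  by (simp_all add: blk11_def blk12_def blk21_def blk22_def vec_eq_iff)

text \<open>The matrices that carry the trajectories starting in the graph of \<open>P0\<close>: a trajectory with
  \<open>x s = v\<close> and \<open>y s = P0 *v v\<close> is \<open>flow_x \<Phi> s P0 t *v v\<close>, \<open>flow_y \<Phi> s P0 t *v v\<close>.\<close>

definition flow_x :: "(real \<Rightarrow> real \<Rightarrow> real^('n::finite + 'n)^('n + 'n)) \<Rightarrow> real \<Rightarrow> real^'n^'n \<Rightarrow> real \<Rightarrow> real^'n^'n" where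
  "flow_x \<Phi> s P0 t = blk11 (\<Phi> t s) + blk12 (\<Phi> t s) ** P0"

definition flow_y :: "(real \<Rightarrow> real \<Rightarrow> real^('n::finite + 'n)^('n + 'n)) \<Rightarrow> real \<Rightarrow> real^'n^'n \<Rightarrow> real \<Rightarrow> real^'n^'n" where
  "flow_y \<Phi> s P0 t = blk21 (\<Phi> t s) + blk22 (\<Phi> t s) ** P0"

text \<open>For \<open>s \<noteq> T\<close> this is the matrix \<open>W\<close> for which the trajectory from \<open>(v, W *v v)\<close> at time \<open>s\<close>
  has \<open>x T = 0\<close>.
  For \<open>T = 0\<close> and \<open>T = 1\<close> it is the lower and the upper bound on Riccati solutions at time \<open>s\<close>.\<close>

definition conj_bound :: "(real \<Rightarrow> real \<Rightarrow> real^('n::finite + 'n)^('n + 'n)) \<Rightarrow> real \<Rightarrow> real \<Rightarrow> real^'n^'n" where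
  "conj_bound \<Phi> T s = - (matrix_inv (blk12 (\<Phi> T s)) ** blk11 (\<Phi> T s))"

locale hamiltonian_system =
  fixes A :: "real \<Rightarrow> real^'n^'n"
    and B :: "real \<Rightarrow> real^'p^'n"
    and Q :: "real \<Rightarrow> real^'n^'n"
    and \<Phi> :: "real \<Rightarrow> real \<Rightarrow> real^('n + 'n)^('n + 'n)"
  assumes A_smooth: "Ck_on (CARD('n) - 1) A {0..1}"
    and B_smooth: "Ck_on CARD('n) B {0..1}"
    and Q_continuous: "continuous_on {0..1} Q"
    and Q_sym: "t \<in> {0..1} \<Longrightarrow> sym_matrix (Q t)"
    and Q_nonneg: "t \<in> {0..1} \<Longrightarrow> 0 \<le> v \<bullet> (Q t *v v)"
    and transition: "state_transition (ham_matrix A B Q) \<Phi>"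
    and controllable: "totally_controllable A B"
begin

lemma A_continuous: "continuous_on {0..1} A"
  by (rule Ck_on_imp_continuous_on[OF A_smooth])

lemma BBt_continuous: "continuous_on {0..1} (\<lambda>t. B t ** transpose (B t))"
  by (intro matmat.continuous_on bounded_linear.continuous_on[OF bounded_linear_transpose]
      Ck_on_imp_continuous_on[OF B_smooth])

lemma transition_derivative:
  assumes s: "s \<in> {0..1}" and t: "t \<in> {0..1}"
  shows "((\<lambda>t. blk11 (\<Phi> t s)) has_vector_derivative
      A t ** blk11 (\<Phi> t s) - B t ** transpose (B t) ** blk21 (\<Phi> t s)) (at t within {0..1})"
    and "((\<lambda>t. blk12 (\<Phi> t s)) has_vector_derivative
      A t ** blk12 (\<Phi> t s) - B t ** transpose (B t) ** blk22 (\<Phi> t s)) (at t within {0..1})"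
    and "((\<lambda>t. blk21 (\<Phi> t s)) has_vector_derivative
      - (Q t ** blk11 (\<Phi> t s)) - transpose (A t) ** blk21 (\<Phi> t s)) (at t within {0..1})"
    and "((\<lambda>t. blk22 (\<Phi> t s)) has_vector_derivative
      - (Q t ** blk12 (\<Phi> t s)) - transpose (A t) ** blk22 (\<Phi> t s)) (at t within {0..1})"
proof -
  have d: "((\<lambda>t. \<Phi> t s) has_vector_derivative ham_matrix A B Q t ** \<Phi> t s) (at t within {0..1})"
    using transition s t unfolding state_transition_def by blast
  note d' = bounded_linear_blk[THEN bounded_linear.has_vector_derivative, OF d]
  from d'(1) show "((\<lambda>t. blk11 (\<Phi> t s)) has_vector_derivative
      A t ** blk11 (\<Phi> t s) - B t ** transpose (B t) ** blk21 (\<Phi> t s)) (at t within {0..1})"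
    by (simp add: ham_matrix_def blk_block_mat_mult matmat.minus_left)
  from d'(2) show "((\<lambda>t. blk12 (\<Phi> t s)) has_vector_derivative
      A t ** blk12 (\<Phi> t s) - B t ** transpose (B t) ** blk22 (\<Phi> t s)) (at t within {0..1})"
    by (simp add: ham_matrix_def blk_block_mat_mult matmat.minus_left)
  from d'(3) show "((\<lambda>t. blk21 (\<Phi> t s)) has_vector_derivative
      - (Q t ** blk11 (\<Phi> t s)) - transpose (A t) ** blk21 (\<Phi> t s)) (at t within {0..1})"
    by (simp add: ham_matrix_def blk_block_mat_mult matmat.minus_left)
  from d'(4) show "((\<lambda>t. blk22 (\<Phi> t s)) has_vector_derivative
      - (Q t ** blk12 (\<Phi> t s)) - transpose (A t) ** blk22 (\<Phi> t s)) (at t within {0..1})"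
    by (simp add: ham_matrix_def blk_block_mat_mult matmat.minus_left)
qed

lemma transition_initial:
  assumes "s \<in> {0..1}"
  shows "blk11 (\<Phi> s s) = mat 1" "blk12 (\<Phi> s s) = 0" "blk21 (\<Phi> s s) = 0" "blk22 (\<Phi> s s) = mat 1"
  using transition assms by (simp_all add: state_transition_def blk_mat_1)

lemma ham_traj_transition:
  assumes s: "s \<in> {0..1}"
  shows "ham_traj A B Q (\<lambda>t. blk11 (\<Phi> t s) *v v + blk12 (\<Phi> t s) *v w)
    (\<lambda>t. blk21 (\<Phi> t s) *v v + blk22 (\<Phi> t s) *v w)"
  unfolding ham_traj_def
proof (intro ballI conjI)
  fix t :: real assume t: "t \<in> {0..1}"
  note d = transition_derivative[OF s t, THEN matvec.has_vector_derivative[OF _ has_vector_derivative_const]]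
  from has_vector_derivative_add[OF d(1)[of v] d(2)[of w]]
  show "((\<lambda>t. blk11 (\<Phi> t s) *v v + blk12 (\<Phi> t s) *v w) has_vector_derivative
      A t *v (blk11 (\<Phi> t s) *v v + blk12 (\<Phi> t s) *v w) -
      B t *v (transpose (B t) *v (blk21 (\<Phi> t s) *v v + blk22 (\<Phi> t s) *v w))) (at t within {0..1})"
    by (simp add: matvec.add_right matvec.diff_left matrix_vector_mul_assoc matrix_mul_assoc algebra_simps)
  from has_vector_derivative_add[OF d(3)[of v] d(4)[of w]]
  show "((\<lambda>t. blk21 (\<Phi> t s) *v v + blk22 (\<Phi> t s) *v w) has_vector_derivative
      - (Q t *v (blk11 (\<Phi> t s) *v v + blk12 (\<Phi> t s) *v w)) -
      transpose (A t) *v (blk21 (\<Phi> t s) *v v + blk22 (\<Phi> t s) *v w)) (at t within {0..1})"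
    by (simp add: matvec.add_right matvec.diff_left matvec.minus_left matrix_vector_mul_assoc algebra_simps)
qed

lemma ham_traj_flow:
  assumes s: "s \<in> {0..1}"
  shows "ham_traj A B Q (\<lambda>t. flow_x \<Phi> s P0 t *v v) (\<lambda>t. flow_y \<Phi> s P0 t *v v)"
  using ham_traj_transition[OF s, of v "P0 *v v"]
  by (simp add: flow_x_def flow_y_def matvec.add_left matrix_vector_mul_assoc)

lemma flow_initial:
  assumes "s \<in> {0..1}"
  shows "flow_x \<Phi> s P0 s = mat 1" "flow_y \<Phi> s P0 s = P0"
  by (simp_all add: flow_x_def flow_y_def transition_initial[OF assms])

lemma ham_traj_zero:
  assumes tr: "ham_traj A B Q x y" and s: "s \<in> {0..1}" "x s = 0" "y s = 0" and t: "t \<in> {0..1}"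
  shows "x t = 0" "y t = 0"
proof -
  obtain a where a: "0 \<le> a" "\<And>t v. t \<in> {0..1} \<Longrightarrow> norm (A t *v v) \<le> a * norm v"
    using matrix_family_bounded[OF A_continuous] by metis
  obtain a' where a': "0 \<le> a'" "\<And>t v. t \<in> {0..1} \<Longrightarrow> norm (transpose (A t) *v v) \<le> a' * norm v"
    using matrix_family_bounded[OF bounded_linear.continuous_on[OF bounded_linear_transpose A_continuous]]
    by metis
  obtain b where b: "0 \<le> b" "\<And>t v. t \<in> {0..1} \<Longrightarrow> norm ((B t ** transpose (B t)) *v v) \<le> b * norm v"
    using matrix_family_bounded[OF BBt_continuous] by metis
  obtain q where q: "0 \<le> q" "\<And>t v. t \<in> {0..1} \<Longrightarrow> norm (Q t *v v) \<le> q * norm v"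
    using matrix_family_bounded[OF Q_continuous] by metis
  define z' where "z' t = (A t *v x t - B t *v (transpose (B t) *v y t),
      - (Q t *v x t) - transpose (A t) *v y t)" for t
  have "(x t, y t) = 0"
  proof (rule gronwall_zero[where z = "\<lambda>t. (x t, y t)" and z' = z' and K = "a + b + q + a'"])
    fix t :: real assume t: "t \<in> {0..1}"
    show "((\<lambda>t. (x t, y t)) has_vector_derivative z' t) (at t within {0..1})"
      unfolding z'_def by (rule has_vector_derivative_Pair[OF ham_trajD[OF tr t]])
    have x: "norm (x t) \<le> norm (x t, y t)" by (rule norm_fst_le)
    have y: "norm (y t) \<le> norm (x t, y t)" by (rule norm_snd_le)
    have "norm (z' t) \<le> norm (A t *v x t - (B t ** transpose (B t)) *v y t)
        + norm (- (Q t *v x t) - transpose (A t) *v y t)"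
      unfolding z'_def matrix_vector_mul_assoc[symmetric] by (rule norm_Pair_le)
    also have "\<dots> \<le> (norm (A t *v x t) + norm ((B t ** transpose (B t)) *v y t))
        + (norm (Q t *v x t) + norm (transpose (A t) *v y t))"
      by (intro add_mono order_trans[OF norm_triangle_ineq4]) auto
    also have "\<dots> \<le> (a * norm (x t, y t) + b * norm (x t, y t)) + (q * norm (x t, y t) + a' * norm (x t, y t))"
      by (intro add_mono order_trans[OF a(2)[OF t]] order_trans[OF b(2)[OF t]]
          order_trans[OF q(2)[OF t]] order_trans[OF a'(2)[OF t]] mult_left_mono x y a b q a')
    finally show "norm (z' t) \<le> (a + b + q + a') * norm (x t, y t)"
      by (simp add: algebra_simps)
  qed (use s t in \<open>auto simp: zero_prod_def\<close>)
  then show "x t = 0" "y t = 0" by (simp_all add: zero_prod_def)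
qed

lemma ham_traj_energy:
  assumes "ham_traj A B Q x y" "t \<in> {0..1}"
  shows "((\<lambda>t. x t \<bullet> y t) has_vector_derivative
    - ((norm (transpose (B t) *v y t))\<^sup>2 + x t \<bullet> (Q t *v x t))) (at t within {0..1})"
  using ham_traj_pairing[OF assms(1,1,2)] by (simp add: power2_norm_eq_inner)

lemma ham_traj_symplectic:
  assumes "ham_traj A B Q x y" "ham_traj A B Q u w" and ab: "a \<in> {0..1}" "b \<in> {0..1}"
  shows "x a \<bullet> w a - u a \<bullet> y a = x b \<bullet> w b - u b \<bullet> y b"
proof (rule derivative_zero_imp_const[OF _ ab])
  fix t :: real assume t: "t \<in> {0..1}"
  have "u t \<bullet> (Q t *v x t) = x t \<bullet> (Q t *v u t)"
    using inner_sym_matrix[OF Q_sym[OF t]] by (metis inner_commute)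
  then show "((\<lambda>t. x t \<bullet> w t - u t \<bullet> y t) has_vector_derivative 0) (at t within {0..1})"
    using has_vector_derivative_diff[OF ham_traj_pairing[OF assms(1,2) t] ham_traj_pairing[OF assms(2,1) t]]
    by (simp add: inner_commute)
qed

section \<open>Absence of conjugate points\<close>

lemma adjoint_zero:
  assumes ab: "0 \<le> a" "a < b" "b \<le> 1"
    and e: "\<And>t. t \<in> {a..b} \<Longrightarrow> (e has_vector_derivative - (transpose (A t) *v e t)) (at t within {0..1})"
    and Be: "\<And>t. t \<in> {a..b} \<Longrightarrow> transpose (B t) *v e t = 0" and t: "t \<in> {a..b}"
  shows "e t = 0"
proof (rule controllable_adjoint_zero[OF A_smooth B_smooth controllable ab _ Be t])
  fix t assume "t \<in> {a..b}"
  then show "(e has_vector_derivative - (transpose (A t) *v e t)) (at t within {a..b})"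
    using ab by (intro has_vector_derivative_within_subset[OF e]) auto
qed

lemma ham_traj_dissipation:
  assumes tr: "ham_traj A B Q x y" and uv: "u \<in> {0..1}" "v \<in> {0..1}"
  shows "0 \<le> (v - u) * (x u \<bullet> y u - x v \<bullet> y v)"
  using dissipation_oriented[where h = "\<lambda>t. x t \<bullet> y t", OF ham_traj_energy[OF tr] _ uv] Q_nonneg
  by simp

lemma ham_traj_no_dissipation:
  assumes tr: "ham_traj A B Q x y" and ab: "0 \<le> a" "a < b" "b \<le> 1"
    and eq: "x a \<bullet> y a = x b \<bullet> y b" and t: "t \<in> {a..b}"
  shows "transpose (B t) *v y t = 0"
proof -
  have "(norm (transpose (B t) *v y t))\<^sup>2 + x t \<bullet> (Q t *v x t) = 0"
    using no_dissipation[where h = "\<lambda>t. x t \<bullet> y t", OF ham_traj_energy[OF tr] _ ab eq t] Q_nonneg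
    by simp
  then show ?thesis
    using Q_nonneg[of t "x t"] ab t by (simp add: add_nonneg_eq_0_iff)
qed

text \<open>A trajectory with \<open>x = 0\<close> at two times neither gains nor loses energy in between. Then
  \<open>B\<^sup>T y\<close> is zero between them, which first decouples \<open>x\<close> and makes it zero, and then leaves the adjoint
  equation for \<open>y\<close>, where controllability applies.\<close>

lemma blk12_invertible:
  assumes s: "s \<in> {0..1}" and T: "T \<in> {0..1}" and ne: "s \<noteq> T"
  shows "invertible (blk12 (\<Phi> T s))"
  unfolding invertible_iff_kernel
proof (intro allI impI)
  fix w assume w: "blk12 (\<Phi> T s) *v w = 0"
  define x where "x t = blk12 (\<Phi> t s) *v w" for t
  define y where "y t = blk22 (\<Phi> t s) *v w" for t
  have tr: "ham_traj A B Q x y"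
    using ham_traj_transition[OF s, of 0 w] by (simp add: x_def[abs_def] y_def[abs_def])
  have xs: "x s = 0" and ys: "y s = w" and xT: "x T = 0"
    using w by (simp_all add: x_def y_def transition_initial[OF s])
  define a where "a = min s T"
  define b where "b = max s T"
  have ab: "0 \<le> a" "a < b" "b \<le> 1" and sab: "s \<in> {a..b}"
    using s T ne by (auto simp: a_def b_def)
  have "x a = 0" "x b = 0"
    using xs xT by (auto simp: a_def b_def min_def max_def)
  then have h: "x a \<bullet> y a = x b \<bullet> y b" by simp
  have By: "transpose (B t) *v y t = 0" if "t \<in> {a..b}" for t
    by (rule ham_traj_no_dissipation[OF tr ab h that])
  have x0: "x t = 0" if t: "t \<in> {a..b}" for t
  proof (rule linear_ode_zero[where M = A and z = x, OF _ _ sab xs t])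
    show "continuous_on {a..b} A"
      using ab by (intro continuous_on_subset[OF A_continuous]) auto
    fix t assume t: "t \<in> {a..b}"
    then have t01: "t \<in> {0..1}" using ab by auto
    have "(x has_vector_derivative A t *v x t) (at t within {0..1})"
      using ham_trajD(1)[OF tr t01] By[OF t] by simp
    then show "(x has_vector_derivative A t *v x t) (at t within {a..b})"
      by (rule has_vector_derivative_within_subset) (use ab in auto)
  qed
  have "y s = 0"
  proof (rule adjoint_zero[OF ab _ By sab])
    fix t assume t: "t \<in> {a..b}"
    then have t01: "t \<in> {0..1}" using ab by auto
    show "(y has_vector_derivative - (transpose (A t) *v y t)) (at t within {0..1})"
      using ham_trajD(2)[OF tr t01] x0[OF t] by simp
  qed
  then show "w = 0" by (simp add: ys)
qed

lemma steering_traj: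
  assumes s: "s \<in> {0..1}" and T: "T \<in> {0..1}" and ne: "s \<noteq> T"
  obtains x y where "ham_traj A B Q x y" "x s = v" "y s = conj_bound \<Phi> T s *v v" "x T = 0"
proof
  let ?W = "conj_bound \<Phi> T s"
  show "ham_traj A B Q (\<lambda>t. flow_x \<Phi> s ?W t *v v) (\<lambda>t. flow_y \<Phi> s ?W t *v v)"
    by (rule ham_traj_flow[OF s])
  show "flow_x \<Phi> s ?W s *v v = v" "flow_y \<Phi> s ?W s *v v = ?W *v v"
    by (simp_all add: flow_initial[OF s])
  have "blk12 (\<Phi> T s) ** ?W = - blk11 (\<Phi> T s)"
    by (simp add: conj_bound_def matmat.minus_right matrix_mul_assoc
        matrix_inv_inverse[OF blk12_invertible[OF s T ne]])
  then show "flow_x \<Phi> s ?W T *v v = 0" by (simp add: flow_x_def)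
qed

lemma sym_matrix_conj_bound:
  assumes s: "s \<in> {0..1}" and T: "T \<in> {0..1}" and ne: "s \<noteq> T"
  shows "sym_matrix (conj_bound \<Phi> T s)"
  unfolding sym_matrix_iff_inner
proof (intro allI)
  fix v w
  obtain x y where xy: "ham_traj A B Q x y" "x s = v" "y s = conj_bound \<Phi> T s *v v" "x T = 0"
    by (rule steering_traj[OF s T ne])
  obtain u z where uz: "ham_traj A B Q u z" "u s = w" "z s = conj_bound \<Phi> T s *v w" "u T = 0"
    by (rule steering_traj[OF s T ne])
  show "v \<bullet> (conj_bound \<Phi> T s *v w) = w \<bullet> (conj_bound \<Phi> T s *v v)"
    using ham_traj_symplectic[OF xy(1) uz(1) s T] xy uz by simp
qed

text \<open>Why the bound keeps \<open>X(t) = flow_x \<Phi> s P0 t\<close> invertible, for \<open>s < T\<close>: \<open>v \<bullet> (conj_bound \<Phi> T s *v v)\<close> is the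
  least cost of steering \<open>v\<close> at time \<open>s\<close> to \<open>0\<close> at time \<open>T\<close>. If \<open>X(t) *v v = 0\<close>, the trajectory that
  starts in \<open>(v, P0 *v v)\<close> reaches \<open>0\<close> already at time \<open>t\<close>, with cost \<open>v \<bullet> (P0 *v v)\<close>, and it can stay
  there; so that cost is not below the least one. The proof compares this trajectory with the optimal
  one, \<open>(u, w)\<close>, through the monotone quantity \<open>(x - u) \<bullet> (y - w)\<close> and the conserved symplectic form.\<close>

lemma flow_x_invertible_towards:
  assumes s: "s \<in> {0..1}" and T: "T \<in> {0..1}" and P0: "sym_matrix P0"
    and bound: "\<And>v. v \<noteq> 0 \<Longrightarrow> 0 < (T - s) * (v \<bullet> ((conj_bound \<Phi> T s - P0) *v v))"
    and t: "s < t \<and> t \<le> T \<or> T \<le> t \<and> t < s"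
  shows "invertible (flow_x \<Phi> s P0 t)"
  unfolding invertible_iff_kernel
proof (intro allI impI, rule ccontr)
  fix v assume v: "flow_x \<Phi> s P0 t *v v = 0" "v \<noteq> 0"
  have t01: "t \<in> {0..1}" and ne: "s \<noteq> T" using s T t by auto
  define x where "x r = flow_x \<Phi> s P0 r *v v" for r
  define y where "y r = flow_y \<Phi> s P0 r *v v" for r
  have tr: "ham_traj A B Q x y" and ini: "x s = v" "y s = P0 *v v" and xt: "x t = 0"
    using ham_traj_flow[OF s] v by (simp_all add: x_def[abs_def] y_def[abs_def] flow_initial[OF s])
  obtain u w where uw: "ham_traj A B Q u w" "u s = v" "w s = conj_bound \<Phi> T s *v v" "u T = 0"
    by (rule steering_traj[OF s T ne])
  define d where "d = v \<bullet> ((conj_bound \<Phi> T s - P0) *v v)"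
  define m where "m = u t \<bullet> w t"
  have d: "u t \<bullet> y t = - d"
    using ham_traj_symplectic[OF tr uw(1) s t01] ini uw xt
    by (simp add: d_def matvec.diff_left inner_diff_right)
  have gt: "(x t - u t) \<bullet> (y t - w t) = d + m"
    by (simp add: xt d m_def inner_diff_right)
  have gs: "(x s - u s) \<bullet> (y s - w s) = 0"
    by (simp add: ini uw)
  have "0 \<le> (t - s) * ((x s - u s) \<bullet> (y s - w s) - (x t - u t) \<bullet> (y t - w t))"
    by (rule ham_traj_dissipation[OF ham_traj_diff[OF tr uw(1)] s t01])
  (* In the case s < T: d > 0 and m >= 0, while monotonicity gives d + m <= 0. *)
  then have 1: "(t - s) * (d + m) \<le> 0"
    unfolding gs gt by (simp add: algebra_simps)
  have "0 \<le> (T - t) * (u t \<bullet> w t - u T \<bullet> w T)"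
    by (rule ham_traj_dissipation[OF uw(1) t01 T])
  then have 2: "0 \<le> (T - t) * m" by (simp add: uw m_def)
  have 3: "0 < (T - s) * d" using bound[OF v(2)] by (simp add: d_def)
  have 4: "m = 0" if "t = T" using that uw by (simp add: m_def)
  from t show False
  proof
    assume *: "s < t \<and> t \<le> T"
    then have "0 < d" using 3 by (simp add: zero_less_mult_iff)
    moreover have "0 \<le> m" using 2 4 * by (cases "t = T") (auto simp: zero_le_mult_iff)
    ultimately show False using 1 * by (simp add: mult_le_0_iff)
  next
    assume *: "T \<le> t \<and> t < s"
    then have "d < 0" using 3 by (simp add: zero_less_mult_iff)
    moreover have "m \<le> 0" using 2 4 * by (cases "t = T") (auto simp: zero_le_mult_iff)
    ultimately show False using 1 * by (simp add: mult_le_0_iff)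
  qed
qed

section \<open>Solutions of the Riccati equation\<close>

text \<open>A Riccati solution makes the graph of \<open>P t\<close> invariant under the Hamiltonian flow: the defect
  \<open>y - P x\<close> obeys a homogeneous linear equation.\<close>

lemma riccati_defect:
  assumes P: "riccati_solution A B Q s P0 P" and tr: "ham_traj A B Q x y" and t: "t \<in> {0..1}"
  shows "((\<lambda>t. y t - P t *v x t) has_vector_derivative
    (P t ** B t ** transpose (B t) - transpose (A t)) *v (y t - P t *v x t)) (at t within {0..1})"
proof -
  have "(P has_vector_derivative - (transpose (A t) ** P t) - P t ** A t
      + P t ** B t ** transpose (B t) ** P t - Q t) (at t within {0..1})"
    using P t by (simp add: riccati_solution_def)
  from has_vector_derivative_diff[OF ham_trajD(2)[OF tr t]
      matvec.has_vector_derivative[OF this ham_trajD(1)[OF tr t]]]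
  show ?thesis
    by (simp add: matvec.diff_left matvec.diff_right matvec.add_left matvec.minus_left
        matmat.diff_left matrix_vector_mul_assoc matrix_mul_assoc algebra_simps)
qed

lemma riccati_continuous:
  assumes "riccati_solution A B Q s P0 P"
  shows "continuous_on {0..1} P"
  by (rule has_vector_derivative_continuous_on[OF bspec[OF conjunct2[OF assms[unfolded riccati_solution_def]]]])

lemma riccati_graph_invariant:
  assumes P: "riccati_solution A B Q s P0 P" and tr: "ham_traj A B Q x y"
    and r: "r \<in> {0..1}" "y r = P r *v x r" and t: "t \<in> {0..1}"
  shows "y t = P t *v x t"
proof -
  have "continuous_on {0..1} (\<lambda>t. P t ** (B t ** transpose (B t)) - transpose (A t))"
    by (intro continuous_on_diff matmat.continuous_on riccati_continuous[OF P] BBt_continuous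
        bounded_linear.continuous_on[OF bounded_linear_transpose] A_continuous)
  then have c: "continuous_on {0..1} (\<lambda>t. P t ** B t ** transpose (B t) - transpose (A t))"
    by (simp add: matrix_mul_assoc)
  have "y t - P t *v x t = 0"
    using linear_ode_zero[OF c riccati_defect[OF P tr] r(1) _ t] r(2) by simp
  then show ?thesis by simp
qed

lemma riccati_flow:
  assumes P: "riccati_solution A B Q s P0 P" and s: "s \<in> {0..1}" and t: "t \<in> {0..1}"
  shows "invertible (flow_x \<Phi> s P0 t)"
    and "P t = flow_y \<Phi> s P0 t ** matrix_inv (flow_x \<Phi> s P0 t)"
proof -
  have Ps: "P s = P0" using P by (simp add: riccati_solution_def)
  have yPx: "flow_y \<Phi> s P0 t *v v = P t *v (flow_x \<Phi> s P0 t *v v)" for v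
    by (rule riccati_graph_invariant[OF P ham_traj_flow[OF s] s _ t])
       (simp add: flow_initial[OF s] Ps)
  show inv: "invertible (flow_x \<Phi> s P0 t)"
    unfolding invertible_iff_kernel
  proof (intro allI impI)
    fix v assume v: "flow_x \<Phi> s P0 t *v v = 0"
    then have "flow_y \<Phi> s P0 t *v v = 0" by (simp add: yPx)
    with v have "flow_x \<Phi> s P0 s *v v = 0"
      by (intro ham_traj_zero(1)[OF ham_traj_flow[OF s] t _ _ s])
    then show "v = 0" by (simp add: flow_initial[OF s])
  qed
  have "flow_y \<Phi> s P0 t = P t ** flow_x \<Phi> s P0 t"
    unfolding matrix_eq by (simp add: yPx matrix_vector_mul_assoc[symmetric])
  then show "P t = flow_y \<Phi> s P0 t ** matrix_inv (flow_x \<Phi> s P0 t)"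
    by (simp add: matrix_mul_assoc[symmetric] matrix_inv_inverse[OF inv])
qed

lemma riccati_unique:
  assumes "riccati_solution A B Q s P0 P" "riccati_solution A B Q s P0 P'" "s \<in> {0..1}" "t \<in> {0..1}"
  shows "P' t = P t"
  using riccati_flow(2)[OF assms(1,3,4)] riccati_flow(2)[OF assms(2,3,4)] by simp

text \<open>This carries the bounds from the prescribed time over to all other times.\<close>

lemma riccati_restart:
  "riccati_solution A B Q s P0 P \<Longrightarrow> riccati_solution A B Q t (P t) P"
  by (simp add: riccati_solution_def)

text \<open>The transpose of a solution solves the same problem, so uniqueness gives symmetry.\<close>

lemma riccati_sym:
  assumes P: "riccati_solution A B Q s P0 P" and P0: "sym_matrix P0"
    and s: "s \<in> {0..1}" and t: "t \<in> {0..1}"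
  shows "sym_matrix (P t)"
proof -
  have "riccati_solution A B Q s P0 (\<lambda>t. transpose (P t))"
    unfolding riccati_solution_def
  proof (intro conjI ballI)
    show "transpose (P s) = P0"
      using P P0 by (simp add: riccati_solution_def sym_matrix_def)
    fix t :: real assume t: "t \<in> {0..1}"
    have "(P has_vector_derivative - (transpose (A t) ** P t) - P t ** A t
        + P t ** B t ** transpose (B t) ** P t - Q t) (at t within {0..1})"
      using P t by (simp add: riccati_solution_def)
    from bounded_linear.has_vector_derivative[OF bounded_linear_transpose this]
    show "((\<lambda>t. transpose (P t)) has_vector_derivative
        - (transpose (A t) ** transpose (P t)) - transpose (P t) ** A t
        + transpose (P t) ** B t ** transpose (B t) ** transpose (P t) - Q t) (at t within {0..1})"
      using Q_sym[OF t]
      by (simp add: transpose_add transpose_diff transpose_minus transpose_matrix_mult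
          matrix_mul_assoc sym_matrix_def algebra_simps)
  qed
  from riccati_unique[OF P this s t] show ?thesis by (simp add: sym_matrix_def)
qed

lemma riccati_exists:
  assumes s: "s \<in> {0..1}" and inv: "\<And>t. t \<in> {0..1} \<Longrightarrow> invertible (flow_x \<Phi> s P0 t)"
  shows "riccati_solution A B Q s P0 (\<lambda>t. flow_y \<Phi> s P0 t ** matrix_inv (flow_x \<Phi> s P0 t))"
  unfolding riccati_solution_def
proof (intro conjI ballI)
  show "flow_y \<Phi> s P0 s ** matrix_inv (flow_x \<Phi> s P0 s) = P0"
    using matrix_inv_inverse(1)[OF inv[OF s]] by (simp add: flow_initial[OF s])
  fix t :: real assume t: "t \<in> {0..1}"
  let ?X = "flow_x \<Phi> s P0" and ?Y = "flow_y \<Phi> s P0"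
  let ?Z = "\<lambda>t. matrix_inv (?X t)"
  note d = transition_derivative[OF s]
  note dc = d[THEN matmat.has_vector_derivative[OF _ has_vector_derivative_const]]
  have X: "(?X has_vector_derivative A t ** ?X t - B t ** transpose (B t) ** ?Y t) (at t within {0..1})"
    if "t \<in> {0..1}" for t
    using has_vector_derivative_add[OF d(1)[OF that] dc(2)[OF that, of P0]]
    by (simp add: flow_x_def[abs_def] flow_y_def[abs_def] matmat.add_right matmat.diff_left
        matrix_mul_assoc algebra_simps)
  have Y: "(?Y has_vector_derivative - (Q t ** ?X t) - transpose (A t) ** ?Y t) (at t within {0..1})"
    using has_vector_derivative_add[OF d(3)[OF t] dc(4)[OF t, of P0]]
    by (simp add: flow_x_def[abs_def] flow_y_def[abs_def] matmat.add_right matmat.diff_left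
        matmat.minus_left matrix_mul_assoc algebra_simps)
  have XZ: "Y' ** ?X t ** ?Z t = Y'" for Y' :: "real^'n^'n"
    by (simp add: matrix_mul_assoc[symmetric] matrix_inv_inverse[OF inv[OF t]])
  from matmat.has_vector_derivative[OF Y has_vector_derivative_matrix_inv[OF X inv t]]
  show "((\<lambda>t. ?Y t ** ?Z t) has_vector_derivative
      - (transpose (A t) ** (?Y t ** ?Z t)) - ?Y t ** ?Z t ** A t
      + ?Y t ** ?Z t ** B t ** transpose (B t) ** (?Y t ** ?Z t) - Q t) (at t within {0..1})"
    by (simp add: matmat.diff_left matmat.diff_right matmat.minus_left matmat.minus_right
        matrix_mul_assoc XZ algebra_simps)
qed

text \<open>Along the trajectory that is steered to \<open>0\<close> at \<open>T\<close>, completing the square with a Riccati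
  solution gives \<open>(x \<bullet> (y - P x))' = - (norm (B\<^sup>T (y - P x)))\<^sup>2\<close>, so that the gap between
  \<open>conj_bound \<Phi> T s\<close> and \<open>P s\<close> is a dissipated energy.\<close>

lemma riccati_conj_bound:
  assumes P: "riccati_solution A B Q s P0 P" and sym: "sym_matrix P0"
    and s: "s \<in> {0..1}" and T: "T \<in> {0..1}" and ne: "s \<noteq> T" and v: "v \<noteq> 0"
  shows "0 < (T - s) * (v \<bullet> ((conj_bound \<Phi> T s - P0) *v v))"
proof -
  have Ps: "P s = P0" using P by (simp add: riccati_solution_def)
  obtain x y where tr: "ham_traj A B Q x y" and ini: "x s = v" "y s = conj_bound \<Phi> T s *v v"
    and xT: "x T = 0"
    by (rule steering_traj[OF s T ne])
  define e where "e t = y t - P t *v x t" for t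
  define h where "h t = x t \<bullet> e t" for t
  define c where "c t = (norm (transpose (B t) *v e t))\<^sup>2" for t
  have de: "(e has_vector_derivative (P t ** B t ** transpose (B t) - transpose (A t)) *v e t)
      (at t within {0..1})" if "t \<in> {0..1}" for t
    unfolding e_def[abs_def] by (rule riccati_defect[OF P tr that])
  have dh: "(h has_vector_derivative - c t) (at t within {0..1})" if t: "t \<in> {0..1}" for t
  proof -
    have "x t \<bullet> (P t *v (B t *v (transpose (B t) *v e t)))
        = (B t *v (transpose (B t) *v (P t *v x t))) \<bullet> e t"
      by (simp add: inner_sym_matrix[OF riccati_sym[OF P sym s t], symmetric]
          inner_transpose_left inner_transpose_right inner_commute)
         (metis inner_commute inner_transpose_left)
    then have "x t \<bullet> ((P t ** B t ** transpose (B t) - transpose (A t)) *v e t)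
        + (A t *v x t - B t *v (transpose (B t) *v y t)) \<bullet> e t
      = - ((B t *v (transpose (B t) *v (y t - P t *v x t))) \<bullet> e t)"
      by (simp add: matvec.diff_left matvec.diff_right inner_diff_left inner_diff_right
          inner_transpose_right matrix_vector_mul_assoc[symmetric])
    also have "\<dots> = - c t"
      unfolding e_def[symmetric] c_def power2_norm_eq_inner
      by (simp add: inner_transpose_right inner_commute)
    finally show ?thesis
      using bounded_bilinear.has_vector_derivative[OF bounded_bilinear_inner
          ham_trajD(1)[OF tr t] de[OF t]] by (simp add: h_def[abs_def])
  qed
  have c: "0 \<le> c t" for t by (simp add: c_def)
  have hT: "h T = 0" by (simp add: h_def xT)
  have hs: "h s = v \<bullet> ((conj_bound \<Phi> T s - P0) *v v)"
    by (simp add: h_def e_def ini Ps matvec.diff_left)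
  have "0 \<le> (T - s) * (h s - h T)"
    by (rule dissipation_oriented[OF dh c s T])
  moreover have "h s \<noteq> 0"
  proof
    assume hs0: "h s = 0"
    define a where "a = min s T"
    define b where "b = max s T"
    have ab: "0 \<le> a" "a < b" "b \<le> 1" and Tab: "T \<in> {a..b}"
      using s T ne by (auto simp: a_def b_def)
    have hab: "h a = h b"
      using hs0 hT by (auto simp: a_def b_def min_def max_def)
    have Be: "transpose (B t) *v e t = 0" if "t \<in> {a..b}" for t
      using no_dissipation[OF dh c ab hab that] by (simp add: c_def)
    (* With no dissipation e is zero, so at T both x and y = P x are zero. *)
    have "e T = 0"
    proof (rule adjoint_zero[OF ab _ Be Tab])
      fix t assume t: "t \<in> {a..b}"
      then have t01: "t \<in> {0..1}" using ab by auto
      show "(e has_vector_derivative - (transpose (A t) *v e t)) (at t within {0..1})"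
        using de[OF t01] Be[OF t]
        by (simp add: matvec.diff_left matrix_vector_mul_assoc[symmetric])
    qed
    then have "y T = 0" by (simp add: e_def xT)
    then have "x s = 0" by (rule ham_traj_zero(1)[OF tr T xT _ s])
    then show False using v ini by simp
  qed
  ultimately show ?thesis
    using ne by (simp add: hT hs less_le)
qed

text \<open>The factor \<^term>\<open>T - t\<close> is negative for the endpoint \<open>0\<close> and positive for the endpoint \<open>1\<close>; it turns the
  lower and the upper bound into two instances of one inequality.\<close>

lemma riccati_bounds_iff:
  assumes t: "t \<in> {0..1}" and X: "sym_matrix X"
  shows "riccati_bounds \<Phi> t X \<longleftrightarrow>
    (\<forall>T\<in>{0,1}. T \<noteq> t \<longrightarrow> (\<forall>v. v \<noteq> 0 \<longrightarrow> 0 < (T - t) * (v \<bullet> ((conj_bound \<Phi> T t - X) *v v))))"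
proof -
  have "conj_bound \<Phi> 0 t \<prec>\<^sub>L X \<longleftrightarrow>
      (\<forall>v. v \<noteq> 0 \<longrightarrow> 0 < (0 - t) * (v \<bullet> ((conj_bound \<Phi> 0 t - X) *v v)))" if "t \<noteq> 0"
    using sym_matrix_conj_bound[OF t, of 0] X that t
    by (simp add: loewner_less_def matvec.diff_left inner_diff_right mult_less_0_iff)
  moreover have "X \<prec>\<^sub>L conj_bound \<Phi> 1 t \<longleftrightarrow>
      (\<forall>v. v \<noteq> 0 \<longrightarrow> 0 < (1 - t) * (v \<bullet> ((conj_bound \<Phi> 1 t - X) *v v)))" if "t \<noteq> 1"
    using sym_matrix_conj_bound[OF t, of 1] X that t
    by (simp add: loewner_less_def matvec.diff_left inner_diff_right zero_less_mult_iff)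
  ultimately show ?thesis
    unfolding riccati_bounds_def conj_bound_def[symmetric] by auto
qed

lemma riccati_imp_bounds:
  assumes "riccati_solution A B Q s P0 P" "sym_matrix P0" "s \<in> {0..1}"
  shows "riccati_bounds \<Phi> s P0"
  unfolding riccati_bounds_iff[OF assms(3,2)]
  by (intro ballI impI allI riccati_conj_bound[OF assms]) auto

lemma bounds_imp_flow_x_invertible:
  assumes b: "riccati_bounds \<Phi> s P0" and P0: "sym_matrix P0"
    and s: "s \<in> {0..1}" and t: "t \<in> {0..1}"
  shows "invertible (flow_x \<Phi> s P0 t)"
proof -
  note b' = b[unfolded riccati_bounds_iff[OF s P0], rule_format]
  consider "t = s" | "s < t" | "t < s" by linarith
  then show ?thesis
  proof cases
    case 1
    then show ?thesis by (simp add: flow_initial[OF s] invertible_iff_kernel)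
  next
    case 2
    then show ?thesis
      using s t by (intro flow_x_invertible_towards[OF s, of 1] P0 b') auto
  next
    case 3
    then show ?thesis
      using s t by (intro flow_x_invertible_towards[OF s, of 0] P0 b') auto
  qed
qed

end

theorem lemma6:
  fixes A :: "real \<Rightarrow> real^'n^'n"
    and B :: "real \<Rightarrow> real^'p^'n"
    and Q :: "real \<Rightarrow> real^'n^'n"
    and \<Phi> :: "real \<Rightarrow> real \<Rightarrow> real^('n + 'n)^('n + 'n)"
    and s :: real
    and P0 :: "real^'n^'n"
  assumes "Ck_on (CARD('n) - 1) A {0..1}"
    and "Ck_on CARD('n) B {0..1}"
    and "continuous_on {0..1} Q"
    and "\<forall>t\<in>{0..1}. sym_matrix (Q t) \<and> 0 \<preceq>\<^sub>L Q t"
    and "state_transition (ham_matrix A B Q) \<Phi>"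
    and "totally_controllable A B"
    and "s \<in> {0..1}"
    and "sym_matrix P0"
  shows
    "((\<exists>P. riccati_solution A B Q s P0 P \<and>
         (\<forall>P'. riccati_solution A B Q s P0 P' \<longrightarrow> (\<forall>t\<in>{0..1}. P' t = P t)))
       \<longleftrightarrow> riccati_bounds \<Phi> s P0) \<and>
     (riccati_bounds \<Phi> s P0 \<longrightarrow>
       (\<forall>P. riccati_solution A B Q s P0 P \<longrightarrow>
         (\<forall>t\<in>{0..1}.
            invertible (blk11 (\<Phi> t s) + blk12 (\<Phi> t s) ** P0) \<and>
            P t = (blk21 (\<Phi> t s) + blk22 (\<Phi> t s) ** P0) **
                  matrix_inv (blk11 (\<Phi> t s) + blk12 (\<Phi> t s) ** P0) \<and>
            riccati_bounds \<Phi> t (P t))))"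
proof -
  interpret hamiltonian_system A B Q \<Phi>
    using assms(1-6) by unfold_locales (auto simp: loewner_le_def)
  note s = assms(7) and P0 = assms(8)
  show ?thesis
  proof (intro conjI impI allI ballI iffI)
    assume "\<exists>P. riccati_solution A B Q s P0 P \<and>
      (\<forall>P'. riccati_solution A B Q s P0 P' \<longrightarrow> (\<forall>t\<in>{0..1}. P' t = P t))"
    then show "riccati_bounds \<Phi> s P0"
      using riccati_imp_bounds[OF _ P0 s] by blast
  next
    assume "riccati_bounds \<Phi> s P0"
    from riccati_exists[OF s bounds_imp_flow_x_invertible[OF this P0 s]]
    show "\<exists>P. riccati_solution A B Q s P0 P \<and>
      (\<forall>P'. riccati_solution A B Q s P0 P' \<longrightarrow> (\<forall>t\<in>{0..1}. P' t = P t))"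
      using riccati_unique[OF _ _ s] by blast
  next
    fix P t assume P: "riccati_solution A B Q s P0 P" and t: "t \<in> {0..1::real}"
    show "invertible (blk11 (\<Phi> t s) + blk12 (\<Phi> t s) ** P0)"
      "P t = (blk21 (\<Phi> t s) + blk22 (\<Phi> t s) ** P0) **
        matrix_inv (blk11 (\<Phi> t s) + blk12 (\<Phi> t s) ** P0)"
      using riccati_flow[OF P s t] by (simp_all add: flow_x_def flow_y_def)
    show "riccati_bounds \<Phi> t (P t)"
      by (rule riccati_imp_bounds[OF riccati_restart[OF P] riccati_sym[OF P P0 s t] t])
  qed
qed

end
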